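(* Let $k\ge 2$ be an integer. There exist an integer $p_0(k)$ and a constant $C=C(k)>0$ such that for every prime $p>p_0(k)$, $$p^{1/k}-1\le f^{(D)}(p,k)\le C(p\log p)^{1/k}.$$
   Context: For a finite abelian group $G$ (written additively) and a non-empty set $A\subseteq\mathbb{Z}\setminus\{0\}$, the weighted Davenport constant $D_A(G)$ is the least positive integer $k$ such that for every sequence $(x_1,\ldots,x_k)$ of elements of $G$ there exist a non-empty subsequence $(x_{i_1},\ldots,x_{i_t})$ and elements $a_1,\ldots,a_t\in A$ with $\sum_{j=1}^t a_jx_{i_j}=0$ (here $ax$ is the $a$-fold sum of $x$ for $a>0$ and $ax=(-a)(-x)$ for $a<0$). For $G$ of exponent $n$ and an integer $k\ge 2$, $f^{(D)}_G(k):=\min\{|A|:\emptyset\ne A\subseteq[1,n-1],\ D_A(G)\le k\}$, with $f^{(D)}_G(k)=\infty$ if no such $A$ exists. For the cyclic group $\mathbb{Z}_n$ write $f^{(D)}(n,k):=f^{(D)}_{\mathbb{Z}_n}(k)$. Here $[a,b]=\{a,a+1,\ldots,b\}$. *)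

theory Defs
  imports
    Complex_Main
    "HOL-Algebra.FiniteProduct"
    "HOL-Algebra.Elementary_Groups"
    "HOL-Computational_Algebra.Primes"
    "HOL-Library.Extended_Real"
begin

text \<open>
  Abelian groups are those of HOL-Algebra and hence written multiplicatively: \<open>x [^]\<^bsub>G\<^esub> a\<close> is the
  integer multiple \<open>a x\<close>, \<open>finprod G\<close> is the finite sum and \<open>\<one>\<^bsub>G\<^esub>\<close> is the zero element.
\<close>

text \<open>
  A subsequence of \<open>xs\<close> is given by its set \<open>I\<close> of positions, so repeated terms of \<open>xs\<close> may be
  chosen separately; the weights \<open>a i\<close> need not be distinct.
\<close>

definition has_weighted_zero_sum :: "('a, 'b) monoid_scheme \<Rightarrow> int set \<Rightarrow> 'a list \<Rightarrow> bool" where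
  "has_weighted_zero_sum G A xs \<longleftrightarrow>
     (\<exists>I a. I \<subseteq> {..<length xs} \<and> I \<noteq> {} \<and> (\<forall>i\<in>I. a i \<in> A) \<and>
        finprod G (\<lambda>i. (xs ! i) [^]\<^bsub>G\<^esub> (a i :: int)) I = \<one>\<^bsub>G\<^esub>)"

text \<open>For finite \<open>G\<close> and \<open>A \<noteq> {}\<close> an admissible \<open>k\<close> exists, so the minimum is attained.\<close>

definition weighted_davenport :: "int set \<Rightarrow> ('a, 'b) monoid_scheme \<Rightarrow> nat" where
  "weighted_davenport A G =
     (LEAST k. 0 < k \<and>
        (\<forall>xs. length xs = k \<and> set xs \<subseteq> carrier G \<longrightarrow> has_weighted_zero_sum G A xs))"

definition group_exponent :: "('a, 'b) monoid_scheme \<Rightarrow> nat" where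
  "group_exponent G = (LEAST n::nat. 0 < n \<and> (\<forall>x\<in>carrier G. x [^]\<^bsub>G\<^esub> n = \<one>\<^bsub>G\<^esub>))"

text \<open>The infimum in \<^typ>\<open>enat\<close> is the minimum for nonempty sets and \<open>\<infinity>\<close> for the empty set.\<close>

definition fD_group :: "('a, 'b) monoid_scheme \<Rightarrow> nat \<Rightarrow> enat" where
  "fD_group G k =
     Inf {enat (card A) | A. A \<noteq> {} \<and> A \<subseteq> {1..int (group_exponent G) - 1} \<and>
                             weighted_davenport A G \<le> k}"

definition fD :: "nat \<Rightarrow> nat \<Rightarrow> enat" where
  "fD n k = fD_group (integer_mod_group n) k"

end

theory Submission
  imports Defs
begin

text \<open>
  Both bounds are pigeonhole arguments. Lower bound: a nonzero coefficient vector over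
  \<open>A \<union> {0}\<close> annihilates at most \<open>p ^ (k - 1)\<close> of the \<open>p ^ k\<close> sequences of length \<open>k\<close>, and there are
  at most \<open>(card A + 1) ^ k\<close> such vectors, so \<open>p \<le> (card A + 1) ^ k\<close>. Upper bound: let \<open>m\<close> be the
  integer part of \<open>p powr (1 / k)\<close>. The \<open>(m + 1) ^ k > p\<close> sums with coefficients in \<open>{0..m}\<close> cannot
  all be distinct modulo \<open>p\<close>, and the difference of two equal ones is a zero sum with
  weights in \<open>\<plusminus>{1..m}\<close>. This gives \<open>fD p k \<le> 2 * p powr (1 / k)\<close>, so no logarithm is needed.
\<close>

section \<open>The cyclic group in terms of integers modulo \<open>n\<close>\<close>

lemma group_exponent_integer_mod_group:
  assumes "n > 0"
  shows "group_exponent (integer_mod_group n) = n"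
  unfolding group_exponent_def
proof (rule Least_equality)
  show "0 < n \<and> (\<forall>x\<in>carrier (integer_mod_group n).
      x [^]\<^bsub>integer_mod_group n\<^esub> n = \<one>\<^bsub>integer_mod_group n\<^esub>)"
    using assms by simp
next
  fix m :: nat
  assume m: "0 < m \<and> (\<forall>x\<in>carrier (integer_mod_group n).
      x [^]\<^bsub>integer_mod_group n\<^esub> m = \<one>\<^bsub>integer_mod_group n\<^esub>)"
  show "n \<le> m"
  proof (cases "n = 1")
    \<comment> \<open>The residue 1 has order \<open>n\<close>. It lies outside the carrier exactly
      when \<open>n = 1\<close>, and then the claim is just \<open>0 < m\<close>.\<close>
    case False
    then have "1 [^]\<^bsub>integer_mod_group n\<^esub> m = \<one>\<^bsub>integer_mod_group n\<^esub>"
      using m by (metis integer_mod_group_1)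
    then have "int n dvd int m"
      by auto
    with m show ?thesis
      by (simp add: dvd_imp_le)
  qed (use m in simp)
qed

lemma finprod_integer_mod_group:
  assumes "n > 0" "finite I" "\<And>i. i \<in> I \<Longrightarrow> f i \<in> carrier (integer_mod_group n)"
  shows "finprod (integer_mod_group n) f I = (\<Sum>i\<in>I. f i) mod int n"
proof -
  interpret comm_group "integer_mod_group n" by simp
  show ?thesis
    using assms(2,3)
  proof (induction rule: finite_induct)
    case (insert i I)
    then have "finprod (integer_mod_group n) f (insert i I) =
        (f i + (\<Sum>i\<in>I. f i) mod int n) mod int n"
      by (subst finprod_insert) auto
    with insert show ?case
      by (simp add: mod_add_right_eq)
  qed simp
qed

text \<open>Powers in \<open>integer_mod_group n\<close> are products reduced modulo
  \<open>n\<close>, so a vanishing product becomes a divisibility between integers; all later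
  counting works with this form.\<close>

lemma has_weighted_zero_sum_integer_mod_group:
  assumes "n > 0"
  shows "has_weighted_zero_sum (integer_mod_group n) A xs \<longleftrightarrow>
    (\<exists>I a. I \<subseteq> {..<length xs} \<and> I \<noteq> {} \<and> (\<forall>i\<in>I. a i \<in> A) \<and> int n dvd (\<Sum>i\<in>I. a i * xs ! i))"
proof -
  have "finprod (integer_mod_group n) (\<lambda>i. (xs ! i) [^]\<^bsub>integer_mod_group n\<^esub> (a i :: int)) I =
      (\<Sum>i\<in>I. a i * xs ! i) mod int n" if "I \<subseteq> {..<length xs}" for I a
    using assms that
    by (subst finprod_integer_mod_group)
       (auto simp: int_pow_integer_mod_group carrier_integer_mod_group mod_sum_eq
         intro: finite_subset)
  then show ?thesis
    unfolding has_weighted_zero_sum_def one_integer_mod_group dvd_eq_mod_eq_0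
    by (metis (no_types, lifting))
qed

section \<open>The Davenport constant as a condition on sequences of one length\<close>

text \<open>Positions in a prefix are positions in the whole sequence with the same entries. Hence
  the lengths that force a zero sum are closed upwards.\<close>

lemma has_weighted_zero_sum_take:
  assumes "has_weighted_zero_sum G A (take j xs)" "comm_group G" "set xs \<subseteq> carrier G"
  shows "has_weighted_zero_sum G A xs"
proof -
  interpret comm_group G by fact
  obtain I a where Ia: "I \<subseteq> {..<length (take j xs)}" "I \<noteq> {}" "\<forall>i\<in>I. a i \<in> A"
    "finprod G (\<lambda>i. (take j xs ! i) [^]\<^bsub>G\<^esub> (a i :: int)) I = \<one>\<^bsub>G\<^esub>"
    using assms(1) unfolding has_weighted_zero_sum_def by blast
  have "finprod G (\<lambda>i. (take j xs ! i) [^]\<^bsub>G\<^esub> a i) I = finprod G (\<lambda>i. (xs ! i) [^]\<^bsub>G\<^esub> a i) I"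
    using Ia(1) assms(3) by (intro finprod_cong') (auto simp: subset_iff)
  then show ?thesis
    unfolding has_weighted_zero_sum_def using Ia by (intro exI[of _ I] exI[of _ a]) auto
qed

text \<open>The weight set \<open>{a}\<close> suffices: two of the \<open>n + 1\<close> prefix sums agree.\<close>

lemma has_weighted_zero_sum_length:
  assumes "n > 0" "A \<noteq> {}" "length xs = n"
  shows "has_weighted_zero_sum (integer_mod_group n) A xs"
proof -
  obtain a where "a \<in> A"
    using assms by blast
  define s where "s j = (\<Sum>i<j. xs ! i) mod int n" for j
  have "s ` {..n} \<subseteq> {0..<int n}"
    using assms by (auto simp: s_def)
  then have "card (s ` {..n}) \<le> n"
    using card_mono[of "{0..<int n}"] by fastforce
  then have "\<not> inj_on s {..n}"
    by (intro pigeonhole) auto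
  then obtain i j where ij: "i < j" "j \<le> n" "s i = s j"
    unfolding inj_on_def by (metis atMost_iff linorder_neqE_nat)
  have "(\<Sum>l<j. xs ! l) - (\<Sum>l<i. xs ! l) = (\<Sum>l\<in>{i..<j}. xs ! l)"
    using ij sum_diff_nat_ivl[of 0 i j "(!) xs"] by (simp add: atLeast0LessThan)
  then have "int n dvd (\<Sum>l\<in>{i..<j}. a * xs ! l)"
    using ij(3) by (metis s_def mod_eq_dvd_iff dvd_mult sum_distrib_left)
  then show ?thesis
    unfolding has_weighted_zero_sum_integer_mod_group[OF assms(1)]
    using ij assms \<open>a \<in> A\<close> by (intro exI[of _ "{i..<j}"] exI[of _ "\<lambda>_. a"]) auto
qed

text \<open>The least admissible length is attained, and admissibility passes from it to every
  larger \<open>k\<close> by looking at prefixes of that length.\<close>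

lemma weighted_davenport_le_iff:
  assumes "n > 0" "A \<noteq> {}" "k > 0"
  shows "weighted_davenport A (integer_mod_group n) \<le> k \<longleftrightarrow>
    (\<forall>xs. length xs = k \<and> set xs \<subseteq> carrier (integer_mod_group n) \<longrightarrow>
      has_weighted_zero_sum (integer_mod_group n) A xs)"
    (is "?D \<le> k \<longleftrightarrow> ?P k")
proof
  assume "?P k"
  then show "?D \<le> k"
    unfolding weighted_davenport_def using assms by (intro Least_le) auto
next
  assume le: "?D \<le> k"
  have "0 < ?D \<and> ?P ?D"
    unfolding weighted_davenport_def
    \<comment> \<open>The length \<open>n\<close> is admissible, so \<open>LEAST\<close> ranges over
      a nonempty set and its value has the defining property.\<close>
    by (rule LeastI[of _ n]) (use assms has_weighted_zero_sum_length in blast)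
  then have D: "?P ?D" ..
  show "?P k"
  proof (intro allI impI)
    fix xs assume xs: "length xs = k \<and> set xs \<subseteq> carrier (integer_mod_group n)"
    show "has_weighted_zero_sum (integer_mod_group n) A xs"
    proof (rule has_weighted_zero_sum_take)
      show "has_weighted_zero_sum (integer_mod_group n) A (take ?D xs)"
        using D xs le set_take_subset[of ?D xs] by (metis length_take min.absorb2 subset_trans)
    qed (use xs in auto)
  qed
qed

section \<open>Lower bound: covering all sequences by hyperplanes\<close>

text \<open>As \<open>c i\<close> is invertible modulo \<open>p\<close>, the other
  \<open>k - 1\<close> coordinates of a solution determine the coordinate \<open>x i\<close>, so
  forgetting it is injective.\<close>

lemma card_hyperplane_mod_le:
  fixes c :: "nat \<Rightarrow> int"
  assumes "prime p" "i < k" "\<not> int p dvd c i"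
  shows "card {x \<in> {..<k} \<rightarrow>\<^sub>E {0..<int p}. int p dvd (\<Sum>l<k. c l * x l)} \<le> p ^ (k - 1)"
    (is "card ?S \<le> _")
proof -
  let ?J = "{..<k} - {i}"
  have split: "(\<Sum>l<k. c l * x l) = c i * x i + (\<Sum>l\<in>?J. c l * x l)" for x
    using assms by (intro sum.remove) auto
  have inj: "inj_on (\<lambda>x. restrict x ?J) ?S"
  proof (rule inj_onI)
    fix x y assume x: "x \<in> ?S" and y: "y \<in> ?S" and eq: "restrict x ?J = restrict y ?J"
    have eqJ: "x l = y l" if "l \<in> ?J" for l
      using fun_cong[OF eq, of l] that by auto
    have "(\<Sum>l<k. c l * x l) - (\<Sum>l<k. c l * y l) = c i * (x i - y i)"
      using eqJ by (simp add: split right_diff_distrib)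
    moreover have "int p dvd (\<Sum>l<k. c l * x l) - (\<Sum>l<k. c l * y l)"
      using x y by (intro dvd_diff) auto
    ultimately have "int p dvd x i - y i"
      using assms prime_dvd_mult_iff[of "int p"] by simp
    moreover have "x i \<in> {0..<int p}" "y i \<in> {0..<int p}"
      using x y assms(2) by (auto simp: PiE_iff)
    ultimately have "x i = y i"
      using mod_eq_dvd_iff[of "x i" "int p" "y i"] by simp
    with eqJ have "x l = y l" if "l < k" for l
      using that by (cases "l = i") auto
    with x y show "x = y"
      by (intro PiE_ext[of x "{..<k}" _ y]) auto
  qed
  have "(\<lambda>x. restrict x ?J) ` ?S \<subseteq> ?J \<rightarrow>\<^sub>E {0..<int p}"
    by (intro image_subsetI restrict_PiE_iff[THEN iffD2]) (simp add: PiE_iff)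
  then have "card ?S \<le> card (?J \<rightarrow>\<^sub>E {0..<int p})"
    by (intro card_inj_on_le[OF inj]) (auto intro: finite_PiE)
  also have "\<dots> = p ^ (k - 1)"
    using assms by (simp add: card_PiE)
  finally show ?thesis .
qed

lemma prime_le_if_weighted_davenport_le:
  assumes "prime p" "k > 0" "A \<noteq> {}" "A \<subseteq> {1..int p - 1}"
    and D: "weighted_davenport A (integer_mod_group p) \<le> k"
  shows "p \<le> (card A + 1) ^ k"
proof -
  have p: "p > 0"
    using assms(1) prime_gt_0_nat by blast
  have finA: "finite A"
    using assms(4) finite_subset by blast
  define X where "X = {..<k} \<rightarrow>\<^sub>E {0..<int p}"
  \<comment> \<open>Coefficient 0 marks a position left out of the subsequence; the nonzero entry
    reflects that the subsequence is nonempty.\<close>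
  define C where "C = {c \<in> {..<k} \<rightarrow>\<^sub>E insert 0 A. \<exists>i<k. c i \<noteq> 0}"
  define S where "S c = {x \<in> X. int p dvd (\<Sum>l<k. c l * x l)}" for c :: "nat \<Rightarrow> int"
  have finX: "finite X" and cardX: "card X = p ^ k"
    by (auto simp: X_def card_PiE finite_PiE)
  have finC: "finite C"
    using finA by (auto simp: C_def intro!: finite_Collect_conjI finite_PiE)
  have "card C \<le> card ({..<k} \<rightarrow>\<^sub>E insert 0 A)"
    using finA by (intro card_mono) (auto simp: C_def intro: finite_PiE)
  also have "\<dots> = (card A + 1) ^ k"
    using finA assms(4) by (subst card_PiE) (auto simp: card_insert_if)
  finally have cardC: "card C \<le> (card A + 1) ^ k" .
  have cardS: "card (S c) \<le> p ^ (k - 1)" if c: "c \<in> C" for c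
  proof -
    obtain i where i: "i < k" "c i \<noteq> 0"
      using c by (auto simp: C_def)
    then have "c i \<in> A"
      using c by (auto simp: C_def PiE_iff)
    \<comment> \<open>Weights between 1 and \<open>p - 1\<close> are units modulo \<open>p\<close>,
      as the hyperplane bound requires.\<close>
    then have "0 < c i" "c i < int p"
      using assms(4) by auto
    then have "\<not> int p dvd c i"
      by (rule zdvd_not_zless)
    then show ?thesis
      unfolding S_def X_def using i assms(1) by (intro card_hyperplane_mod_le) auto
  qed
  \<comment> \<open>Each sequence has a weighted zero sum; extending its weights by 0 gives a vector
    of \<open>C\<close> that annihilates the sequence.\<close>
  have "X \<subseteq> (\<Union>c\<in>C. S c)"
  proof
    fix x assume x: "x \<in> X"
    let ?xs = "map x [0..<k]"
    have "length ?xs = k \<and> set ?xs \<subseteq> carrier (integer_mod_group p)"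
      using x p by (auto simp: X_def PiE_iff carrier_integer_mod_group)
    then have "has_weighted_zero_sum (integer_mod_group p) A ?xs"
      using D weighted_davenport_le_iff[OF p assms(3,2)] by blast
    then obtain I a where I: "I \<subseteq> {..<k}" "I \<noteq> {}" "\<forall>i\<in>I. a i \<in> A"
        "int p dvd (\<Sum>i\<in>I. a i * ?xs ! i)"
      unfolding has_weighted_zero_sum_integer_mod_group[OF p] by auto
    define c where "c = restrict (\<lambda>i. if i \<in> I then a i else 0) {..<k}"
    have "(\<Sum>l<k. c l * x l) = (\<Sum>l\<in>I. c l * x l)"
      using I(1) by (intro sum.mono_neutral_right) (auto simp: c_def)
    also have "\<dots> = (\<Sum>i\<in>I. a i * ?xs ! i)"
      using I(1) by (intro sum.cong) (auto simp: c_def)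
    finally have "x \<in> S c"
      using x I(4) by (simp add: S_def)
    moreover obtain i where "i \<in> I"
      using I(2) by blast
    then have "i < k" "c i \<noteq> 0"
      using I(1,3) assms(4) by (auto simp: c_def)
    then have "c \<in> C"
      unfolding C_def using I(3) by (intro CollectI conjI exI[of _ i]) (auto simp: c_def)
    ultimately show "x \<in> (\<Union>c\<in>C. S c)"
      by blast
  qed
  then have "card X \<le> card (\<Union>c\<in>C. S c)"
    using finC finX by (intro card_mono) (auto simp: S_def)
  also have "\<dots> \<le> (\<Sum>c\<in>C. card (S c))"
    by (rule card_UN_le[OF finC])
  also have "\<dots> \<le> card C * p ^ (k - 1)"
    using sum_bounded_above[of C "\<lambda>c. card (S c)" "p ^ (k - 1)"] cardS by simp
  also have "\<dots> \<le> (card A + 1) ^ k * p ^ (k - 1)"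
    using cardC by simp
  finally have "p * p ^ (k - 1) \<le> (card A + 1) ^ k * p ^ (k - 1)"
    using assms(2) by (simp add: cardX power_eq_if)
  then show ?thesis
    using p by simp
qed

section \<open>Upper bound: a symmetric interval of weights\<close>

text \<open>The second interval represents the weights from \<open>-m\<close> to \<open>-1\<close>
  modulo \<open>n\<close>, shifted by \<open>n\<close> to fit into
  \<open>{1..n - 1}\<close>.\<close>

lemma weighted_davenport_symmetric_interval_le:
  assumes "k > 0" "n > 0" "0 < m" "m < n" "n < (m + 1) ^ k"
  shows "weighted_davenport ({1..int m} \<union> {int n - int m..int n - 1}) (integer_mod_group n) \<le> k"
proof -
  let ?A = "{1..int m} \<union> {int n - int m..int n - 1}"
  have "has_weighted_zero_sum (integer_mod_group n) ?A xs" if xs: "length xs = k" for xs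
  proof -
    define F where "F = {..<k} \<rightarrow>\<^sub>E {0..int m}"
    define s where "s g = (\<Sum>i<k. g i * xs ! i) mod int n" for g :: "nat \<Rightarrow> int"
    have cardF: "card F = (m + 1) ^ k"
      by (simp add: F_def card_PiE nat_add_distrib)
    have "s ` F \<subseteq> {0..<int n}"
      using assms by (auto simp: s_def)
    then have "card (s ` F) \<le> n"
      using card_mono[of "{0..<int n}"] by fastforce
    then have "\<not> inj_on s F"
      using assms by (intro pigeonhole) (auto simp: cardF)
    then obtain g h where gh: "g \<in> F" "h \<in> F" "g \<noteq> h" "s g = s h"
      unfolding inj_on_def by blast
    \<comment> \<open>Positions where \<open>g\<close> and \<open>h\<close> agree would get the
      coefficient 0, which is not a weight, so they are dropped; some position remains because
      \<open>g\<close> and \<open>h\<close> differ.\<close>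
    define I where "I = {i. i < k \<and> g i \<noteq> h i}"
    define a where "a i = (g i - h i) mod int n" for i
    have "I \<noteq> {}"
      using gh unfolding F_def I_def by (auto dest: PiE_ext)
    moreover have "a i \<in> ?A" if "i \<in> I" for i
    proof (cases "g i > h i")
      case True
      moreover have "0 \<le> h i" "g i \<le> int m"
        using that gh by (auto simp: I_def F_def PiE_iff)
      ultimately show ?thesis
        using assms by (simp add: a_def mod_pos_pos_trivial)
    next
      case False
      moreover have "g i \<noteq> h i" "0 \<le> g i" "h i \<le> int m"
        using that gh by (auto simp: I_def F_def PiE_iff)
      \<comment> \<open>The difference lies between \<open>-m\<close> and \<open>-1\<close>, and
        \<open>m < n\<close>, so reduction modulo \<open>n\<close> adds \<open>n\<close> exactly
        once: the quotient is \<open>-1\<close>.\<close>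
      moreover from calculation have "a i = g i - h i + int n"
        using assms unfolding a_def by (intro int_mod_pos_eq[of _ _ "-1"]) auto
      ultimately show ?thesis
        by auto
    qed
    moreover have "int n dvd (\<Sum>i\<in>I. a i * xs ! i)"
    proof -
      have "(\<Sum>i\<in>I. a i * xs ! i) mod int n = (\<Sum>i\<in>I. (g i - h i) * xs ! i) mod int n"
        unfolding a_def by (subst (1 2) mod_sum_eq[symmetric]) (simp add: mod_mult_left_eq)
      also have "(\<Sum>i\<in>I. (g i - h i) * xs ! i) = (\<Sum>i<k. (g i - h i) * xs ! i)"
        by (intro sum.mono_neutral_left) (auto simp: I_def)
      also have "\<dots> = (\<Sum>i<k. g i * xs ! i) - (\<Sum>i<k. h i * xs ! i)"
        by (simp add: left_diff_distrib sum_subtractf)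
      also have "\<dots> mod int n = 0"
        using gh(4) by (simp add: s_def mod_eq_dvd_iff)
      finally show ?thesis
        by auto
    qed
    ultimately show ?thesis
      unfolding has_weighted_zero_sum_integer_mod_group[OF assms(2)]
      using xs by (intro exI[of _ I] exI[of _ a]) (auto simp: I_def)
  qed
  then show ?thesis
    using assms by (subst weighted_davenport_le_iff) auto
qed

section \<open>The two bounds for \<open>fD\<close>\<close>

lemma fD_ge:
  assumes "prime p" "k > 0"
  shows "ereal (real p powr (1 / real k) - 1) \<le> ereal_of_enat (fD p k)"
proof -
  have p: "p > 0"
    using assms(1) prime_gt_0_nat by blast
  let ?r = "real p powr (1 / real k) - 1"
  \<comment> \<open>The infimum is taken in \<open>enat\<close>, so the real bound is first rounded
    up to a natural number; this is harmless because \<open>card A\<close> is an integer. An infimum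
    over the empty set is covered too, being infinite.\<close>
  have "nat \<lceil>?r\<rceil> \<le> card A"
    if A: "A \<noteq> {}" "A \<subseteq> {1..int p - 1}" "weighted_davenport A (integer_mod_group p) \<le> k" for A
  proof -
    have "real p \<le> real (card A + 1) ^ k"
      using prime_le_if_weighted_davenport_le[OF assms A] by (metis of_nat_le_iff of_nat_power)
    then have "real p powr (1 / real k) \<le> (real (card A + 1) ^ k) powr (1 / real k)"
      by (intro powr_mono2) auto
    also have "\<dots> = real (card A + 1)"
      using assms by (simp add: powr_powr flip: powr_realpow)
    finally show ?thesis
      by linarith
  qed
  then have "enat (nat \<lceil>?r\<rceil>) \<le> fD p k"
    unfolding fD_def fD_group_def group_exponent_integer_mod_group[OF p]
    by (intro Inf_greatest) (force simp del: nat_le_iff ceiling_diff_one)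
  then have "ereal_of_enat (enat (nat \<lceil>?r\<rceil>)) \<le> ereal_of_enat (fD p k)"
    by (simp only: ereal_of_enat_le_iff)
  moreover have "ereal ?r \<le> ereal_of_enat (enat (nat \<lceil>?r\<rceil>))"
    using real_nat_ceiling_ge[of ?r] by (simp only: ereal_of_enat_simps ereal_less_eq)
  ultimately show ?thesis
    by (rule order_trans[rotated])
qed

lemma fD_le:
  assumes "k \<ge> 2" "n \<ge> 2"
  shows "ereal_of_enat (fD n k) \<le> ereal (2 * real n powr (1 / real k))"
proof -
  let ?r = "real n powr (1 / real k)"
  define m where "m = nat \<lfloor>?r\<rfloor>"
  have r1: "?r \<ge> 1"
    using assms by (intro ge_one_powr_ge_zero) auto
  \<comment> \<open>Here \<open>k \<ge> 2\<close> enters: the root is strictly below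
    \<open>n\<close>, which gives \<open>m < n\<close> and keeps both intervals inside
    \<open>{1..n - 1}\<close>.\<close>
  have "?r < real n powr 1"
    using assms by (intro powr_less_mono) auto
  then have rn: "?r < real n"
    using assms by simp
  have m: "0 < m" "real m \<le> ?r" "?r < real (m + 1)"
    using r1 unfolding m_def by linarith+
  have "real n = ?r ^ k"
    using assms by (simp add: powr_powr flip: powr_realpow)
  also have "\<dots> < real (m + 1) ^ k"
    using m assms by (intro power_strict_mono) auto
  finally have nm: "n < (m + 1) ^ k"
    by (metis of_nat_less_iff of_nat_power)
  let ?A = "{1..int m} \<union> {int n - int m..int n - 1}"
  have mn: "m < n"
    using m rn by linarith
  have "weighted_davenport ?A (integer_mod_group n) \<le> k"
    using assms m mn nm by (intro weighted_davenport_symmetric_interval_le) auto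
  then have "fD n k \<le> enat (card ?A)"
    unfolding fD_def fD_group_def
    using assms m mn
    by (intro Inf_lower CollectI exI[of _ ?A]) (auto simp: group_exponent_integer_mod_group)
  \<comment> \<open>Only an inequality: the two intervals overlap when \<open>2 * m \<ge> n\<close>,
    for example for \<open>n = 2\<close>.\<close>
  also have "card ?A \<le> 2 * m"
    by (rule order_trans[OF card_Un_le]) simp
  then have "enat (card ?A) \<le> enat (2 * m)"
    by simp
  finally have "ereal_of_enat (fD n k) \<le> ereal_of_enat (enat (2 * m))"
    by (simp only: ereal_of_enat_le_iff)
  also have "\<dots> \<le> ereal (2 * ?r)"
    using m by simp
  finally show ?thesis .
qed

theorem theorem1:
  fixes k :: nat
  assumes "k \<ge> 2"
  shows "\<exists>(p0::int) (C::real). C > 0 \<and>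
    (\<forall>p::nat. prime p \<and> int p > p0 \<longrightarrow>
       ereal (real p powr (1 / real k) - 1) \<le> ereal_of_enat (fD p k) \<and>
       ereal_of_enat (fD p k) \<le> ereal (C * (real p * ln (real p)) powr (1 / real k)))"
proof (intro exI[of _ 2] conjI allI impI)
  fix p :: nat
  assume p: "prime p \<and> int p > 2"
  then show "ereal (real p powr (1 / real k) - 1) \<le> ereal_of_enat (fD p k)"
    using assms by (intro fD_ge) auto
  \<comment> \<open>The threshold 2 is chosen for this: \<open>p \<ge> 3\<close> exceeds
    \<open>exp 1\<close>, so the logarithm is at least 1 and inserting it only weakens the bound
    with constant 2.\<close>
  have "exp 1 \<le> real p"
    using exp_le p by linarith
  then have "1 \<le> ln (real p)"
    using p by (subst ln_ge_iff) auto
  then have "real p powr (1 / real k) \<le> (real p * ln (real p)) powr (1 / real k)"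
    using p by (intro powr_mono2) auto
  then show "ereal_of_enat (fD p k) \<le> ereal (2 * (real p * ln (real p)) powr (1 / real k))"
    using assms p by (intro order_trans[OF fD_le]) auto
qed simp

end
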